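(* Let $n\ge1$ and $a\in\{0,1,\dots,n\}$. The map $\delta_a$, defined on the generators of $\mathfrak{aw}(n)$ by $$\delta_a(C_{j\dots k})=\begin{cases} C_{j\dots k} & \text{if } k<a,\\ C_{j\dots k\,k+1} & \text{if } j\le a\le k,\\ C_{j+1\dots k+1} & \text{if } a<j,\end{cases}\qquad 1\le j\le k\le n,$$ defines a morphism of algebras from $\mathfrak{aw}(n)$ to $\mathfrak{aw}(n+1)$.
   Context: Base field $\mathbb{C}(q)$, $q$ an indeterminate. $[A,B]=AB-BA$, $[A,B]_q=\frac{1}{q-q^{-1}}(qAB-q^{-1}BA)$. For $I,J\subseteq\{1,\dots,n\}$, $I<J$ means every element of $I$ is strictly smaller than every element of $J$. A connected subset is a non-empty set of consecutive integers. Two disjoint connected subsets are adjacent if their union is connected. A sequence $(I_1,\dots,I_k)$ of connected subsets is monotonic if $I_1<\dots<I_k$ or $I_1>\dots>I_k$; it is a monotonic sequence of adjacent subsets if moreover $I_j,I_{j+1}$ are adjacent for all $j$. Elements: $C_I$ for $I\subseteq\{1,\dots,n\}$ connected; $C_\varnothing:=1$; $C_{j\dots k}:=C_{\{j,j+1,\dots,k\}}$. Adjacent sets in an index are merged: if $I_1,I_2$ are disjoint, connected and adjacent then $C_{I_1I_2}=C_{I_2I_1}:=C_{I_1\cup I_2}$ (similarly for more sets; e.g. $C_{I_1I_3I_4}$ with $I_3,I_4$ adjacent means $C_{I_1(I_3\cup I_4)}$). If $I_1,I_2$ are disjoint connected subsets and the hole $H$ between them (the set of integers strictly between $I_1$ and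 $I_2$) is non-empty, then $$C_{I_1I_2}:=-[C_{I_1H},C_{HI_2}]_q+C_{I_1}C_{I_2}+C_HC_{I_1HI_2}$$ (the order of the pair $(I_1,I_2)$ matters). The algebra $\mathfrak{aw}(n)$ is the unital associative algebra generated by the $C_I$, $I$ a connected subset of $\{1,\dots,n\}$, with relations: (i) $[C_I,C_J]=0$ for connected $I,J$ with $I\cap J=\varnothing$ or $I\subset J$; (ii) $C_{I_1I_2}=-[C_{I_2I_3},C_{I_1I_3}]_q+C_{I_1}C_{I_2}+C_{I_3}C_{I_1I_2I_3}$ for every monotonic sequence $(I_1,I_2,I_3)$ of adjacent connected subsets; (iii) $C_{I_1I_4}=-[C_{I_1I_3},C_{I_3I_4}]_q+C_{I_1}C_{I_4}+C_{I_3}C_{I_1I_3I_4}$ for every monotonic sequence $(I_1,I_2,I_3,I_4)$ of adjacent connected subsets. *)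

theory Defs
  imports
    Complex_Main
    "HOL-Library.Poly_Mapping"
    "HOL-Computational_Algebra.Polynomial"
    "HOL-Computational_Algebra.Fraction_Field"
    "HOL-Algebra.QuotRing"
    "HOL-Algebra.Module"
begin

section \<open>Free algebras, quotients and morphisms\<close>

text \<open>
  Words under concatenation, written additively because \<^typ>\<open>'w \<Rightarrow>\<^sub>0 'k\<close> is the monoid algebra
  of an additive monoid \<^typ>\<open>'w\<close>: its product is the convolution product.
\<close>

datatype 'g word = Word (letters: "'g list")

instantiation word :: (type) monoid_add
begin

definition zero_word :: "'a word" where
  "0 = Word []"

definition plus_word :: "'a word \<Rightarrow> 'a word \<Rightarrow> 'a word" where
  "u + v = Word (letters u @ letters v)"

instance
  by standard (simp_all add: zero_word_def plus_word_def)

end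

text \<open>
  Algebras over a field (given as a type) are records of type \<^typ>\<open>('k, 'b) module\<close>.
  The library's locale for algebras is not used, as it covers commutative algebras only.
\<close>

definition free_algebra :: "'g set \<Rightarrow> ('k::field, 'g word \<Rightarrow>\<^sub>0 'k) module" where
  "free_algebra G =
    \<lparr>carrier = {p. \<forall>w \<in> Poly_Mapping.keys p. set (letters w) \<subseteq> G},
     mult = (*), one = 1, zero = 0, add = (+),
     smult = (\<lambda>c p. Poly_Mapping.single 0 c * p)\<rparr>"

text \<open>The scalar multiplication of the quotient is defined in the style of \<^const>\<open>rcoset_mult\<close>.\<close>

definition quotient_algebra :: "('k, 'b) module \<Rightarrow> 'b set \<Rightarrow> ('k, 'b set) module" where
  "quotient_algebra A I =
    ring.extend (A Quot I) (module.fields (\<lambda>c X. \<Union>x\<in>X. I +>\<^bsub>A\<^esub> (c \<odot>\<^bsub>A\<^esub> x)))"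

text \<open>Note that \<^const>\<open>ring_hom\<close> includes preservation of the unit.\<close>

definition algebra_hom :: "('k, 'b) module \<Rightarrow> ('k, 'c) module \<Rightarrow> ('b \<Rightarrow> 'c) set" where
  "algebra_hom A B =
    {h \<in> ring_hom A B. \<forall>c. \<forall>x \<in> carrier A. h (c \<odot>\<^bsub>A\<^esub> x) = c \<odot>\<^bsub>B\<^esub> h x}"


section \<open>Connected sets\<close>

definition connected_set :: "nat set \<Rightarrow> bool" where
  "connected_set I \<longleftrightarrow> (\<exists>j k. j \<le> k \<and> I = {j..k})"

definition set_less :: "nat set \<Rightarrow> nat set \<Rightarrow> bool" where
  "set_less I J \<longleftrightarrow> (\<forall>i\<in>I. \<forall>j\<in>J. i < j)"

definition adjacent :: "nat set \<Rightarrow> nat set \<Rightarrow> bool" where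
  "adjacent I J \<longleftrightarrow>
    connected_set I \<and> connected_set J \<and> I \<inter> J = {} \<and> connected_set (I \<union> J)"

definition monotonic_adjacent :: "nat set list \<Rightarrow> bool" where
  "monotonic_adjacent Is \<longleftrightarrow>
    (\<forall>I \<in> set Is. connected_set I) \<and>
    (successively set_less Is \<or> successively (\<lambda>I J. set_less J I) Is) \<and>
    successively adjacent Is"

definition hole :: "nat set \<Rightarrow> nat set \<Rightarrow> nat set" where
  "hole I J = {h. set_less I {h} \<and> set_less {h} J \<or> set_less J {h} \<and> set_less {h} I}"


section \<open>The algebra $\mathfrak{aw}(n)$\<close>

text \<open>The base field $\mathbb{C}(q)$.\<close>

type_synonym Cq = "complex poly fract"

definition q :: Cq where
  "q = Fract [:0, 1:] 1"

type_synonym free_aw = "nat set word \<Rightarrow>\<^sub>0 Cq"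

definition generators :: "nat \<Rightarrow> nat set set" where
  "generators n = {I. connected_set I \<and> I \<subseteq> {1..n}}"

abbreviation free_aw_alg :: "nat \<Rightarrow> (Cq, free_aw) module" where
  "free_aw_alg n \<equiv> free_algebra (generators n)"

text \<open>$[A,B]_q = (q - q^{-1})^{-1} (q AB - q^{-1} BA)$; scalars sit in the degree \<open>0\<close> part.\<close>

definition q_commutator :: "free_aw \<Rightarrow> free_aw \<Rightarrow> free_aw" where
  "q_commutator A B =
    Poly_Mapping.single 0 (1 / (q - inverse q)) *
      (Poly_Mapping.single 0 q * (A * B) - Poly_Mapping.single 0 (inverse q) * (B * A))"

definition C :: "nat set \<Rightarrow> free_aw" where
  "C I = (if I = {} then 1 else Poly_Mapping.single (Word [I]) 1)"

text \<open>
  \<open>C2 I J\<close> is $C_{IJ}$ for disjoint connected sets \<open>I\<close> and \<open>J\<close>. Both cases are needed: adjacent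
  sets are merged, and otherwise the hole between them is non-empty.
\<close>

definition C2 :: "nat set \<Rightarrow> nat set \<Rightarrow> free_aw" where
  "C2 I J =
    (if adjacent I J then C (I \<union> J)
     else let H = hole I J in
       - q_commutator (C (I \<union> H)) (C (H \<union> J)) + C I * C J + C H * C (I \<union> H \<union> J))"

text \<open>A relation $x = y$ is represented by the element $x - y$ of the free algebra.\<close>

inductive_set relations :: "nat \<Rightarrow> free_aw set" for n :: nat where
  commute:
    "C I * C J - C J * C I \<in> relations n"
    if "I \<in> generators n" "J \<in> generators n" "I \<inter> J = {} \<or> I \<subseteq> J"
| three:
    "C2 I1 I2 - (- q_commutator (C2 I2 I3) (C2 I1 I3)
       + C I1 * C I2 + C I3 * C (I1 \<union> I2 \<union> I3)) \<in> relations n"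
    if "{I1, I2, I3} \<subseteq> generators n" "monotonic_adjacent [I1, I2, I3]"
| four:
    "C2 I1 I4 - (- q_commutator (C2 I1 I3) (C2 I3 I4)
       + C I1 * C I4 + C I3 * C2 I1 (I3 \<union> I4)) \<in> relations n"
    if "{I1, I2, I3, I4} \<subseteq> generators n" "monotonic_adjacent [I1, I2, I3, I4]"

definition relation_ideal :: "nat \<Rightarrow> free_aw set" where
  "relation_ideal n = genideal (free_aw_alg n) (relations n)"

definition aw :: "nat \<Rightarrow> (Cq, free_aw set) module" where
  "aw n = quotient_algebra (free_aw_alg n) (relation_ideal n)"

text \<open>The generator $C_I$ as an element of $\mathfrak{aw}(n)$.\<close>

definition aw_C :: "nat \<Rightarrow> nat set \<Rightarrow> free_aw set" where
  "aw_C n I = relation_ideal n +>\<^bsub>free_aw_alg n\<^esub> C I"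


section \<open>Well-definedness\<close>

text \<open>
  \<^const>\<open>genideal\<close> yields the whole type when its argument is not contained in the carrier, and
  the scalar multiplication of a quotient is defined as a union. The facts \<open>relations_carrier\<close> and
  \<open>smult_coset\<close> confirm that both are as intended.
\<close>

lemma keys_uminus: "Poly_Mapping.keys (- p :: 'w \<Rightarrow>\<^sub>0 'k::ab_group_add) = Poly_Mapping.keys p"
  by transfer auto

lemma free_algebra_ring: "ring (free_algebra G)"
proof (rule ringI)
  let ?A = "free_algebra G :: ('b::field, 'a word \<Rightarrow>\<^sub>0 'b) module"
  show "abelian_group ?A"
  proof (rule abelian_groupI)
    fix x y assume "x \<in> carrier ?A" "y \<in> carrier ?A"
    then show "x \<oplus>\<^bsub>?A\<^esub> y \<in> carrier ?A"
      using keys_add[of x y] by (auto simp: free_algebra_def)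
  next
    fix x assume "x \<in> carrier ?A"
    then show "\<exists>y\<in>carrier ?A. y \<oplus>\<^bsub>?A\<^esub> x = \<zero>\<^bsub>?A\<^esub>"
      by (intro bexI[of _ "- x"]) (auto simp: free_algebra_def keys_uminus)
  qed (simp_all add: free_algebra_def add_ac)
  show "Group.monoid ?A"
  proof (rule monoidI)
    fix x y assume "x \<in> carrier ?A" "y \<in> carrier ?A"
    then show "x \<otimes>\<^bsub>?A\<^esub> y \<in> carrier ?A"
      using keys_mult[of x y] by (fastforce simp: free_algebra_def plus_word_def)
  next
    show "\<one>\<^bsub>?A\<^esub> \<in> carrier ?A"
      by (simp add: free_algebra_def zero_word_def)
  qed (simp_all add: free_algebra_def mult.assoc)
qed (simp_all add: free_algebra_def distrib_left distrib_right)

lemma smult_coset: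
  assumes I: "ideal I (free_algebra G)" and x: "x \<in> carrier (free_algebra G)"
  shows "c \<odot>\<^bsub>quotient_algebra (free_algebra G) I\<^esub> (I +>\<^bsub>free_algebra G\<^esub> x)
    = I +>\<^bsub>free_algebra G\<^esub> (c \<odot>\<^bsub>free_algebra G\<^esub> x)"
proof -
  let ?A = "free_algebra G" let ?s = "Poly_Mapping.single 0 c"
  interpret ideal I ?A by fact
  have s: "?s \<in> carrier ?A" by (auto simp: free_algebra_def zero_word_def)
  have sm: "c \<odot>\<^bsub>?A\<^esub> y = ?s \<otimes>\<^bsub>?A\<^esub> y" for y by (simp add: free_algebra_def)
  have "I +>\<^bsub>?A\<^esub> (?s \<otimes>\<^bsub>?A\<^esub> y) = I +>\<^bsub>?A\<^esub> (?s \<otimes>\<^bsub>?A\<^esub> x)" if y: "y \<in> I +>\<^bsub>?A\<^esub> x" for y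
  proof -
    from y obtain i where i: "i \<in> I" "y = i \<oplus>\<^bsub>?A\<^esub> x" by (auto simp: a_r_coset_def')
    then have iA: "i \<in> carrier ?A" using a_Hcarr by blast
    have "?s \<otimes>\<^bsub>?A\<^esub> y = (?s \<otimes>\<^bsub>?A\<^esub> i) \<oplus>\<^bsub>?A\<^esub> (?s \<otimes>\<^bsub>?A\<^esub> x)"
      using i iA s x by (simp add: r_distr)
    moreover have "?s \<otimes>\<^bsub>?A\<^esub> i \<in> I" using i s I_l_closed by blast
    ultimately have "?s \<otimes>\<^bsub>?A\<^esub> y \<in> I +>\<^bsub>?A\<^esub> (?s \<otimes>\<^bsub>?A\<^esub> x)" by (auto simp: a_r_coset_def')
    then show ?thesis by (metis a_repr_independence' s x m_closed)
  qed
  moreover have "x \<in> I +>\<^bsub>?A\<^esub> x" using x a_rcos_self by blast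
  ultimately have "(\<Union>y\<in>I +>\<^bsub>?A\<^esub> x. I +>\<^bsub>?A\<^esub> (?s \<otimes>\<^bsub>?A\<^esub> y)) = I +>\<^bsub>?A\<^esub> (?s \<otimes>\<^bsub>?A\<^esub> x)"
    by blast
  then show ?thesis
    by (simp add: quotient_algebra_def ring.extend_def module.fields_def sm)
qed

lemma C_carrier: "I \<in> generators n \<Longrightarrow> C I \<in> carrier (free_aw_alg n)"
  by (auto simp: C_def free_algebra_def zero_word_def)

lemma free_aw_closed:
  assumes x: "x \<in> carrier (free_aw_alg n)" and y: "y \<in> carrier (free_aw_alg n)"
  shows "x + y \<in> carrier (free_aw_alg n)" "x * y \<in> carrier (free_aw_alg n)"
    "- x \<in> carrier (free_aw_alg n)" "x - y \<in> carrier (free_aw_alg n)"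
proof -
  interpret ring "free_aw_alg n" by (rule free_algebra_ring)
  show "x + y \<in> carrier (free_aw_alg n)" "x * y \<in> carrier (free_aw_alg n)"
    using a_closed[OF x y] m_closed[OF x y] by (simp_all add: free_algebra_def)
  show "- x \<in> carrier (free_aw_alg n)"
    using x by (simp add: free_algebra_def keys_uminus)
  show "x - y \<in> carrier (free_aw_alg n)"
    using x y keys_diff[of x y] by (auto simp: free_algebra_def)
qed

lemma q_commutator_carrier:
  assumes "A \<in> carrier (free_aw_alg n)" "B \<in> carrier (free_aw_alg n)"
  shows "q_commutator A B \<in> carrier (free_aw_alg n)"
proof -
  have "Poly_Mapping.single 0 c \<in> carrier (free_aw_alg n)" for c
    by (auto simp: free_algebra_def zero_word_def)
  then show ?thesis using assms by (simp add: q_commutator_def free_aw_closed)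
qed

lemma connected_atLeastAtMost: "a \<le> b \<Longrightarrow> connected_set {a..b}"
  unfolding connected_set_def by blast

lemma generators_atLeastAtMost:
  assumes "1 \<le> a" "a \<le> b" "b \<le> n"
  shows "{a..b} \<in> generators n"
proof -
  have "connected_set {a..b}" using assms unfolding connected_set_def by blast
  then show ?thesis using assms by (simp add: generators_def)
qed

lemma generatorsE:
  assumes "I \<in> generators n"
  obtains a b where "I = {a..b}" "1 \<le> a" "a \<le> b" "b \<le> n"
proof -
  from assms obtain a b where ab: "a \<le> b" "I = {a..b}" and sub: "I \<subseteq> {1..n}"
    unfolding generators_def connected_set_def by blast
  have "1 \<le> a" "b \<le> n" using ab sub by simp_all
  then show ?thesis using ab that by blast
qed

lemma set_less_atLeastAtMost:
  assumes "a \<le> b" "c \<le> d"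
  shows "set_less {a..b} {c..d} \<longleftrightarrow> b < c"
proof
  assume "set_less {a..b} {c..d}"
  moreover have "b \<in> {a..b}" "c \<in> {c..d}" using assms by simp_all
  ultimately show "b < c" unfolding set_less_def by blast
next
  assume bc: "b < c"
  have "i < j" if "i \<in> {a..b}" "j \<in> {c..d}" for i j
    using that bc unfolding atLeastAtMost_iff by linarith
  then show "set_less {a..b} {c..d}" unfolding set_less_def by blast
qed

lemma connected_setE:
  assumes "connected_set I"
  obtains a b where "I = {a..b}" "a \<le> b"
  using assms unfolding connected_set_def by blast

lemma connected_Un_iff:
  assumes "a \<le> b" "b < c" "c \<le> d"
  shows "connected_set ({a..b} \<union> {c..d}) \<longleftrightarrow> c = Suc b"
proof
  assume "connected_set ({a..b} \<union> {c..d})"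
  then obtain x y where xy: "{a..b} \<union> {c..d} = {x..y}" by (rule connected_setE)
  have "b \<in> {a..b} \<union> {c..d}" "c \<in> {a..b} \<union> {c..d}" using assms by simp_all
  then have "Suc b \<in> {x..y}" using assms unfolding xy by simp
  then have "Suc b \<in> {a..b} \<union> {c..d}" unfolding xy .
  then show "c = Suc b" using assms by simp
next
  assume "c = Suc b"
  then have "{a..b} \<union> {c..d} = {a..d}"
    using assms by (intro Set.set_eqI) (simp, linarith)
  then show "connected_set ({a..b} \<union> {c..d})"
    using assms by (simp add: connected_atLeastAtMost)
qed

lemma adjacent_sym: "adjacent I J \<longleftrightarrow> adjacent J I"
  by (auto simp: adjacent_def Un_commute Int_commute)

lemma adjacent_atLeastAtMost:
  assumes "a \<le> b" "b < c" "c \<le> d"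
  shows "adjacent {a..b} {c..d} \<longleftrightarrow> c = Suc b"
proof -
  have "connected_set {a..b}" "connected_set {c..d}" "{a..b} \<inter> {c..d} = {}"
    using assms by (simp_all add: connected_atLeastAtMost)
  then show ?thesis using connected_Un_iff[OF assms] by (simp add: adjacent_def)
qed

lemma hole_sym: "hole I J = hole J I"
  by (auto simp: hole_def)

lemma hole_atLeastAtMost:
  assumes "a \<le> b" "b < c" "c \<le> d"
  shows "hole {a..b} {c..d} = {Suc b..c - 1}"
proof -
  have s: "set_less {x..y} {h} \<longleftrightarrow> y < h" "set_less {h} {x..y} \<longleftrightarrow> h < x" if "x \<le> y" for x y h
    using that set_less_atLeastAtMost[of x y h h] set_less_atLeastAtMost[of h h x y] by simp_all
  have 1: "h \<in> hole {a..b} {c..d} \<longleftrightarrow> b < h \<and> h < c \<or> d < h \<and> h < a" for h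
    unfolding hole_def mem_Collect_eq using assms by (simp add: s)
  have 2: "b < h \<and> h < c \<or> d < h \<and> h < a \<longleftrightarrow> h \<in> {Suc b..c - 1}" for h
    using assms unfolding atLeastAtMost_iff by linarith
  show ?thesis by (rule Set.set_eqI) (simp only: 1 2)
qed

lemma C2_carrier:
  assumes "I \<in> generators n" "J \<in> generators n" "set_less I J \<or> set_less J I"
  shows "C2 I J \<in> carrier (free_aw_alg n)"
proof -
  have *: "C2 I J \<in> carrier (free_aw_alg n) \<and> C2 J I \<in> carrier (free_aw_alg n)"
    if IJ: "I \<in> generators n" "J \<in> generators n" "set_less I J" for I J
  proof -
    from IJ(1) obtain a b where I: "I = {a..b}" "1 \<le> a" "a \<le> b" "b \<le> n" by (rule generatorsE)
    from IJ(2) obtain c d where J: "J = {c..d}" "1 \<le> c" "c \<le> d" "d \<le> n" by (rule generatorsE)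
    have bc: "b < c" using IJ(3) I J by (simp add: set_less_atLeastAtMost)
    have adj: "adjacent I J \<longleftrightarrow> c = Suc b" "adjacent J I \<longleftrightarrow> c = Suc b"
      using adjacent_atLeastAtMost[of a b c d] adjacent_sym[of I J] I J bc by auto
    show ?thesis
    proof (cases "c = Suc b")
      case True
      then have "I \<union> J = {a..d}" "J \<union> I = {a..d}" using I J by auto
      then show ?thesis
        using True adj I J by (simp add: C2_def C_carrier generators_atLeastAtMost)
    next
      case False
      have H: "hole I J = {Suc b..c - 1}" "hole J I = {Suc b..c - 1}"
        using hole_atLeastAtMost[of a b c d] hole_sym[of I J] I J bc by auto
      have U: "I \<union> {Suc b..c - 1} = {a..c - 1}" "{Suc b..c - 1} \<union> J = {Suc b..d}"
        "J \<union> {Suc b..c - 1} = {Suc b..d}" "{Suc b..c - 1} \<union> I = {a..c - 1}"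
        "{a..c - 1} \<union> J = {a..d}" "{Suc b..d} \<union> I = {a..d}"
        using I J bc by auto
      have "{a..c - 1} \<in> generators n" "{Suc b..d} \<in> generators n"
        "{Suc b..c - 1} \<in> generators n" "{a..d} \<in> generators n"
        using I J bc False by (auto intro!: generators_atLeastAtMost)
      then show ?thesis
        unfolding C2_def Let_def H U using False adj IJ
        by (simp add: C_carrier free_aw_closed q_commutator_carrier)
    qed
  qed
  show ?thesis using assms *[of I J] *[of J I] by blast
qed

lemma adjacent_Un_generators:
  assumes "I \<in> generators n" "J \<in> generators n" "adjacent I J"
  shows "I \<union> J \<in> generators n"
  using assms by (auto simp: adjacent_def generators_def)

lemma set_less_trans:
  assumes "set_less I J" "set_less J K" "J \<in> generators n"
  shows "set_less I K"
proof -
  from assms(3) obtain a b where "J = {a..b}" "a \<le> b" by (rule generatorsE)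
  then have "a \<in> J" by simp
  then show ?thesis using assms(1,2) unfolding set_less_def by (meson less_trans)
qed

lemma Un3_generators:
  assumes "I \<in> generators n" "J \<in> generators n" "K \<in> generators n" "adjacent I J" "adjacent J K"
  shows "I \<union> J \<union> K \<in> generators n"
proof -
  have adj: "connected_set (I \<union> J)" "connected_set (J \<union> K)"
    using assms(4,5) by (simp_all add: adjacent_def)
  obtain a b where ab: "I \<union> J = {a..b}" "a \<le> b"
    using adj(1) by (rule connected_setE)
  obtain c d where cd: "J \<union> K = {c..d}" "c \<le> d"
    using adj(2) by (rule connected_setE)
  obtain x y where xy: "J = {x..y}" "x \<le> y"
    using assms(2) by (rule generatorsE)
  have "x \<in> J" using xy by simp
  then have "x \<in> {a..b}" "x \<in> {c..d}" using ab cd by auto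
  then have "{a..b} \<union> {c..d} = {min a c..max b d}" "min a c \<le> max b d" by auto
  moreover have "I \<union> J \<union> K = {a..b} \<union> {c..d}" using ab cd by auto
  ultimately have "connected_set (I \<union> J \<union> K)" by (simp add: connected_atLeastAtMost)
  then show ?thesis using assms by (auto simp: generators_def)
qed

lemma relations_carrier: "relations n \<subseteq> carrier (free_aw_alg n)"
proof
  note cl = free_aw_closed q_commutator_carrier C_carrier C2_carrier
  fix x assume "x \<in> relations n"
  then show "x \<in> carrier (free_aw_alg n)"
  proof cases
    case (commute I J)
    then show ?thesis by (simp add: cl)
  next
    case (three I1 I2 I3)
    then have g: "I1 \<in> generators n" "I2 \<in> generators n" "I3 \<in> generators n"
      and ad: "adjacent I1 I2" "adjacent I2 I3"
      and mo: "set_less I1 I2 \<and> set_less I2 I3 \<or> set_less I2 I1 \<and> set_less I3 I2"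
      by (simp_all add: monotonic_adjacent_def)
    have "set_less I1 I3 \<or> set_less I3 I1" using mo set_less_trans g by blast
    moreover have "set_less I1 I2 \<or> set_less I2 I1" "set_less I2 I3 \<or> set_less I3 I2"
      using mo by blast+
    ultimately show ?thesis unfolding three(1)
      using Un3_generators[OF g ad] g by (simp add: cl)
  next
    case (four I1 I2 I3 I4)
    then have g: "I1 \<in> generators n" "I2 \<in> generators n" "I3 \<in> generators n" "I4 \<in> generators n"
      and ad: "adjacent I3 I4"
      and mo: "set_less I1 I2 \<and> set_less I2 I3 \<and> set_less I3 I4 \<or>
        set_less I2 I1 \<and> set_less I3 I2 \<and> set_less I4 I3"
      by (simp_all add: monotonic_adjacent_def)
    have 1: "set_less I1 I3 \<and> set_less I1 I4 \<or> set_less I3 I1 \<and> set_less I4 I1"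
      using mo set_less_trans g by blast
    then have "set_less I1 (I3 \<union> I4) \<or> set_less (I3 \<union> I4) I1" by (auto simp: set_less_def)
    moreover have "set_less I1 I3 \<or> set_less I3 I1" "set_less I1 I4 \<or> set_less I4 I1"
      "set_less I3 I4 \<or> set_less I4 I3"
      using 1 mo by blast+
    ultimately show ?thesis unfolding four(1)
      using adjacent_Un_generators[OF g(3,4) ad] g by (simp add: cl)
  qed
qed

end

theory Submission
  imports Defs
begin

text \<open>
  The index map of \<open>\<delta>\<^sub>a\<close> is \<open>I \<mapsto> \<sigma>\<^sup>-\<^sup>1(I)\<close> for the monotone surjection \<open>\<sigma>\<close> of the natural numbers
  that identifies \<open>a\<close> and \<open>a + 1\<close>. Taking preimages under \<open>\<sigma>\<close> preserves connectedness, order,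
  adjacency, unions and holes, so \<open>C\<^sub>I\<^sub>J\<close> is sent to \<open>C\<close> with indices \<open>\<sigma>\<^sup>-\<^sup>1(I)\<close>, \<open>\<sigma>\<^sup>-\<^sup>1(J)\<close>, and each
  defining relation of \<open>aw(n)\<close> becomes a defining relation of \<open>aw(n + 1)\<close> of the same type.
\<close>

section \<open>Morphisms of free algebras and their quotients\<close>

text \<open>Every element is a finite sum of monomials over \<open>G\<close>, so additive properties
  need checking on monomials only; the coefficient \<open>0\<close> covers the zero element.\<close>

lemma free_algebra_induct [consumes 1, case_names single add]:
  assumes p: "p \<in> carrier (free_algebra G)"
    and single: "\<And>w c. set (letters w) \<subseteq> G \<Longrightarrow> P (Poly_Mapping.single w c)"
    and add: "\<And>f g. f \<in> carrier (free_algebra G) \<Longrightarrow> g \<in> carrier (free_algebra G) \<Longrightarrow>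
      P f \<Longrightarrow> P g \<Longrightarrow> P (f + g)"
  shows "P p"
  using p
proof (induction p rule: Poly_Mapping.update_induct)
  case const
  then show ?case using single[of 0 0] by (simp add: zero_word_def)
next
  case (update f w c)
  have eq: "Poly_Mapping.update w c f = f + Poly_Mapping.single w c"
    using update.hyps(1)
    by (intro poly_mapping_eqI)
      (auto simp: lookup_update lookup_add lookup_single in_keys_iff when_def)
  \<comment> \<open>The new word is not a key of \<open>f\<close> and its coefficient is non-zero,
    so nothing cancels: both summands inherit membership in the carrier.\<close>
  have k: "Poly_Mapping.keys (Poly_Mapping.update w c f) = insert w (Poly_Mapping.keys f)"
    using update.hyps by (simp add: keys_update)
  then have "f \<in> carrier (free_algebra G)" "set (letters w) \<subseteq> G"
    using update.prems by (auto simp: free_algebra_def)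
  then show ?case unfolding eq using update.IH single
    by (intro add) (auto simp: free_algebra_def)
qed

lemma free_algebra_smult_closed:
  assumes "x \<in> carrier (free_algebra G)"
  shows "c \<odot>\<^bsub>free_algebra G\<^esub> x \<in> carrier (free_algebra G)"
proof -
  let ?s = "Poly_Mapping.single 0 c"
  interpret ring "free_algebra G" by (rule free_algebra_ring)
  have "?s \<in> carrier (free_algebra G)" by (auto simp: free_algebra_def zero_word_def)
  then have "?s \<otimes>\<^bsub>free_algebra G\<^esub> x \<in> carrier (free_algebra G)" using assms by (rule m_closed)
  then show ?thesis by (simp add: free_algebra_def)
qed

text \<open>The functorial action of the free algebra on maps of letters: the linear extension of
  \<open>map_word f\<close>. Since it is a sum of monomials, coefficients add up correctly even if
  \<open>f\<close> is not injective.\<close>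

definition free_algebra_map :: "('g \<Rightarrow> 'h) \<Rightarrow> ('g word \<Rightarrow>\<^sub>0 'k::field) \<Rightarrow> ('h word \<Rightarrow>\<^sub>0 'k)" where
  "free_algebra_map f p =
    (\<Sum>w\<in>Poly_Mapping.keys p. Poly_Mapping.single (map_word f w) (Poly_Mapping.lookup p w))"

lemma map_word_plus: "map_word f (u + v) = map_word f u + map_word f v"
  by (cases u; cases v) (simp add: plus_word_def)

lemma map_word_zero: "map_word f 0 = 0"
  by (simp add: zero_word_def)

lemma free_algebra_map_single [simp]:
  "free_algebra_map f (Poly_Mapping.single w c) = Poly_Mapping.single (map_word f w) c"
  by (simp add: free_algebra_map_def)

lemma free_algebra_map_one [simp]: "free_algebra_map f 1 = 1"
  by (metis free_algebra_map_single map_word_zero single_one)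

lemma free_algebra_map_add:
  "free_algebra_map f (x + y) = free_algebra_map f x + free_algebra_map f y"
  unfolding free_algebra_map_def
  by (rule setsum_keys_plus_distrib) (simp_all add: single_add)

lemma free_algebra_map_diff:
  "free_algebra_map f (x - y) = free_algebra_map f x - free_algebra_map f y"
  by (metis add_diff_cancel_right' diff_add_cancel free_algebra_map_add)

lemma free_algebra_map_uminus: "free_algebra_map f (- x) = - free_algebra_map f x"
  by (metis diff_self free_algebra_map_diff diff_0)

lemma free_algebra_map_mult:
  "free_algebra_map f (x * y) = free_algebra_map f x * free_algebra_map f y"
proof -
  \<comment> \<open>Over the alphabet \<open>UNIV\<close> the carrier is the whole type, so the
    induction applies to arbitrary \<open>x\<close> and \<open>y\<close>. Bilinearity reduces the
    claim to two monomials, where it says that \<open>map_word f\<close> respects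
    concatenation.\<close>
  have "x \<in> carrier (free_algebra UNIV)" "y \<in> carrier (free_algebra UNIV)"
    by (simp_all add: free_algebra_def)
  then show ?thesis
  proof (induction x rule: free_algebra_induct)
    case (single u c)
    from single(2) show ?case
      by (induction y rule: free_algebra_induct)
        (simp_all add: mult_single map_word_plus distrib_left free_algebra_map_add)
  next
    case (add x x')
    then show ?case by (simp add: distrib_right free_algebra_map_add)
  qed
qed

lemma free_algebra_map_hom:
  assumes "f ` G \<subseteq> H"
  shows "free_algebra_map f \<in> algebra_hom (free_algebra G) (free_algebra H)"
proof -
  have "free_algebra_map f p \<in> carrier (free_algebra H)" if "p \<in> carrier (free_algebra G)" for p
    using that
  proof (induction p rule: free_algebra_induct)
    case (single w c)
    then show ?case using assms by (cases w) (auto simp: free_algebra_def)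
  next
    case (add x y)
    interpret ring "free_algebra H" by (rule free_algebra_ring)
    show ?case unfolding free_algebra_map_add
      using a_closed[OF add.IH] by (simp add: free_algebra_def)
  qed
  moreover have "free_algebra_map f (c \<odot>\<^bsub>free_algebra G\<^esub> x) = c \<odot>\<^bsub>free_algebra H\<^esub> free_algebra_map f x"
    for c x
    by (simp add: free_algebra_def free_algebra_map_mult map_word_zero)
  ultimately show ?thesis
    unfolding algebra_hom_def
    by (auto intro!: ring_hom_memI)
      (simp_all add: free_algebra_def free_algebra_map_mult free_algebra_map_add)
qed

section \<open>Quotient algebras and their homomorphisms\<close>

lemma quotient_algebra_sel:
  "carrier (quotient_algebra A I) = carrier (A Quot I)"
  "mult (quotient_algebra A I) = mult (A Quot I)"
  "one (quotient_algebra A I) = one (A Quot I)"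
  "add (quotient_algebra A I) = add (A Quot I)"
  by (simp_all add: quotient_algebra_def ring.extend_def)

lemma carrier_quotient_algebra:
  "carrier (quotient_algebra A I) = (\<lambda>x. I +>\<^bsub>A\<^esub> x) ` carrier A"
  by (auto simp: quotient_algebra_sel FactRing_def A_RCOSETS_def')

lemma quotient_algebra_projection:
  assumes "ideal I (free_algebra G)"
  shows "(\<lambda>x. I +>\<^bsub>free_algebra G\<^esub> x) \<in> algebra_hom (free_algebra G) (quotient_algebra (free_algebra G) I)"
  using ideal.rcos_ring_hom[OF assms] smult_coset[OF assms]
  by (auto simp: algebra_hom_def ring_hom_def quotient_algebra_sel)

text \<open>The universal property of the quotient: as \<open>F\<close> carries \<open>I\<close>
  into \<open>J\<close>, the class of \<open>F x\<close> depends only on the class of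
  \<open>x\<close>.\<close>

lemma quotient_algebra_map:
  assumes I: "ideal I (free_algebra G)" and J: "ideal J (free_algebra H)"
    and F: "F \<in> algebra_hom (free_algebra G) (free_algebra H)" and FI: "F ` I \<subseteq> J"
  obtains h where
    "h \<in> algebra_hom (quotient_algebra (free_algebra G) I) (quotient_algebra (free_algebra H) J)"
    "\<And>x. x \<in> carrier (free_algebra G) \<Longrightarrow>
      h (I +>\<^bsub>free_algebra G\<^esub> x) = J +>\<^bsub>free_algebra H\<^esub> F x"
proof -
  let ?A = "free_algebra G" let ?B = "free_algebra H"
  let ?QA = "quotient_algebra ?A I" let ?QB = "quotient_algebra ?B J"
  interpret A: ring ?A by (rule free_algebra_ring)
  interpret B: ring ?B by (rule free_algebra_ring)
  have Fr: "F \<in> ring_hom ?A ?B" using F by (simp add: algebra_hom_def)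
  interpret F: ring_hom_ring ?A ?B F
    using Fr by (intro ring_hom_ringI2 A.ring_axioms B.ring_axioms)
  \<comment> \<open>A representative of the coset is chosen; the next fact shows that the choice
    does not matter, because two representatives differ by an element of \<open>I\<close>.\<close>
  define h where "h X = J +>\<^bsub>?B\<^esub> F (SOME x. x \<in> carrier ?A \<and> I +>\<^bsub>?A\<^esub> x = X)" for X
  have h: "h (I +>\<^bsub>?A\<^esub> x) = J +>\<^bsub>?B\<^esub> F x" if x: "x \<in> carrier ?A" for x
  proof -
    define y where "y = (SOME y. y \<in> carrier ?A \<and> I +>\<^bsub>?A\<^esub> y = I +>\<^bsub>?A\<^esub> x)"
    have y: "y \<in> carrier ?A \<and> I +>\<^bsub>?A\<^esub> y = I +>\<^bsub>?A\<^esub> x"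
      unfolding y_def by (rule someI[of _ x]) (use x in simp)
    then have "y \<ominus>\<^bsub>?A\<^esub> x \<in> I" using A.quotient_eq_iff_same_a_r_cos[OF I] x by blast
    then have "F (y \<ominus>\<^bsub>?A\<^esub> x) \<in> J" using FI by blast
    then have "F y \<ominus>\<^bsub>?B\<^esub> F x \<in> J" using x y by (simp add: a_minus_def)
    then have "J +>\<^bsub>?B\<^esub> F y = J +>\<^bsub>?B\<^esub> F x"
      using B.quotient_eq_iff_same_a_r_cos[OF J] x y by simp
    then show ?thesis by (simp add: h_def y_def)
  qed
  note pA = quotient_algebra_projection[OF I] and pB = quotient_algebra_projection[OF J]
  have smF: "F (c \<odot>\<^bsub>?A\<^esub> x) = c \<odot>\<^bsub>?B\<^esub> F x" if "x \<in> carrier ?A" for c x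
    using F that by (simp add: algebra_hom_def)
  have "h \<in> ring_hom ?QA ?QB"
  proof (rule ring_hom_memI)
    fix X assume "X \<in> carrier ?QA"
    then show "h X \<in> carrier ?QB" by (auto simp: carrier_quotient_algebra h)
  next
    fix X Y assume "X \<in> carrier ?QA" "Y \<in> carrier ?QA"
    then obtain x y where xy: "x \<in> carrier ?A" "y \<in> carrier ?A"
      "X = I +>\<^bsub>?A\<^esub> x" "Y = I +>\<^bsub>?A\<^esub> y"
      by (auto simp: carrier_quotient_algebra)
    have "X \<otimes>\<^bsub>?QA\<^esub> Y = I +>\<^bsub>?A\<^esub> (x \<otimes>\<^bsub>?A\<^esub> y)" "X \<oplus>\<^bsub>?QA\<^esub> Y = I +>\<^bsub>?A\<^esub> (x \<oplus>\<^bsub>?A\<^esub> y)"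
      using pA xy by (simp_all add: algebra_hom_def ring_hom_def)
    moreover have "h X \<otimes>\<^bsub>?QB\<^esub> h Y = J +>\<^bsub>?B\<^esub> (F x \<otimes>\<^bsub>?B\<^esub> F y)"
      "h X \<oplus>\<^bsub>?QB\<^esub> h Y = J +>\<^bsub>?B\<^esub> (F x \<oplus>\<^bsub>?B\<^esub> F y)"
      using pB xy by (simp_all add: h algebra_hom_def ring_hom_def)
    ultimately show "h (X \<otimes>\<^bsub>?QA\<^esub> Y) = h X \<otimes>\<^bsub>?QB\<^esub> h Y" "h (X \<oplus>\<^bsub>?QA\<^esub> Y) = h X \<oplus>\<^bsub>?QB\<^esub> h Y"
      using xy by (simp_all add: h)
  next
    have "\<one>\<^bsub>?QA\<^esub> = I +>\<^bsub>?A\<^esub> \<one>\<^bsub>?A\<^esub>" "\<one>\<^bsub>?QB\<^esub> = J +>\<^bsub>?B\<^esub> \<one>\<^bsub>?B\<^esub>"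
      using pA pB by (simp_all add: algebra_hom_def ring_hom_def)
    then show "h \<one>\<^bsub>?QA\<^esub> = \<one>\<^bsub>?QB\<^esub>" by (simp add: h)
  qed
  moreover have "h (c \<odot>\<^bsub>?QA\<^esub> X) = c \<odot>\<^bsub>?QB\<^esub> h X" if X: "X \<in> carrier ?QA" for c X
  proof -
    obtain x where x: "x \<in> carrier ?A" "X = I +>\<^bsub>?A\<^esub> x"
      using X by (auto simp: carrier_quotient_algebra)
    then show ?thesis by (simp add: smult_coset[OF I] smult_coset[OF J] h free_algebra_smult_closed smF)
  qed
  ultimately have "h \<in> algebra_hom ?QA ?QB" by (simp add: algebra_hom_def)
  then show thesis using h that by blast
qed

lemma algebra_hom_comp:
  assumes "f \<in> algebra_hom A B" "g \<in> algebra_hom B D"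
  shows "g \<circ> f \<in> algebra_hom A D"
  using assms ring_hom_trans[of f A B g D]
  by (auto simp: algebra_hom_def ring_hom_closed)

text \<open>The carrier of the quotient is closed under all operations, scalar multiplication
  included, so the homomorphism laws never look outside it. This allows passing to an extensional
  map, for which uniqueness makes sense.\<close>

lemma algebra_hom_restrict:
  assumes "f \<in> algebra_hom (quotient_algebra (free_algebra G) I) B"
    and I: "ideal I (free_algebra G)"
  shows "restrict f (carrier (quotient_algebra (free_algebra G) I))
    \<in> algebra_hom (quotient_algebra (free_algebra G) I) B"
proof -
  let ?A = "free_algebra G" let ?Q = "quotient_algebra ?A I"
  interpret Q: ring "?A Quot I" by (rule ideal.quotient_is_ring[OF I])
  have sm: "c \<odot>\<^bsub>?Q\<^esub> X \<in> carrier ?Q" if X: "X \<in> carrier ?Q" for c X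
  proof -
    obtain x where x: "x \<in> carrier ?A" "X = I +>\<^bsub>?A\<^esub> x"
      using X by (auto simp: carrier_quotient_algebra)
    then show ?thesis
      by (simp add: smult_coset[OF I] carrier_quotient_algebra free_algebra_smult_closed)
  qed
  show ?thesis
    using assms(1) sm unfolding algebra_hom_def ring_hom_def
    by (auto simp: quotient_algebra_sel)
qed

text \<open>The record \<open>B\<close> is arbitrary, so only preservation of the operations can be
  used. It determines the value on a monomial by recursion on its word, and additivity extends this
  to sums.\<close>

lemma free_algebra_hom_eqI:
  fixes f g :: "('g word \<Rightarrow>\<^sub>0 'k::field) \<Rightarrow> 'b"
  assumes f: "f \<in> algebra_hom (free_algebra G) B" and g: "g \<in> algebra_hom (free_algebra G) B"
    and fg: "\<And>x. x \<in> G \<Longrightarrow> f (Poly_Mapping.single (Word [x]) 1) = g (Poly_Mapping.single (Word [x]) 1)"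
    and p: "p \<in> carrier (free_algebra G)"
  shows "f p = g p"
  using p
proof (induction p rule: free_algebra_induct)
  case (single w c)
  let ?A = "free_algebra G :: ('k, 'g word \<Rightarrow>\<^sub>0 'k) module"
  \<comment> \<open>The coefficient stays with the tail of the word until the empty word is reached,
    where it acts on the unit.\<close>
  have *: "h (Poly_Mapping.single (Word []) c) = c \<odot>\<^bsub>B\<^esub> \<one>\<^bsub>B\<^esub>"
    "x \<in> G \<Longrightarrow> set xs \<subseteq> G \<Longrightarrow> h (Poly_Mapping.single (Word (x # xs)) c)
      = h (Poly_Mapping.single (Word [x]) 1) \<otimes>\<^bsub>B\<^esub> h (Poly_Mapping.single (Word xs) c)"
    if h: "h \<in> algebra_hom ?A B" for h :: "('g word \<Rightarrow>\<^sub>0 'k) \<Rightarrow> 'b" and x xs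
  proof -
    have hr: "h \<in> ring_hom ?A B" and hs: "\<forall>c. \<forall>x\<in>carrier ?A. h (c \<odot>\<^bsub>?A\<^esub> x) = c \<odot>\<^bsub>B\<^esub> h x"
      using h by (simp_all add: algebra_hom_def)
    have 1: "\<one>\<^bsub>?A\<^esub> \<in> carrier ?A" "Poly_Mapping.single (Word []) c = c \<odot>\<^bsub>?A\<^esub> \<one>\<^bsub>?A\<^esub>"
      by (simp_all add: free_algebra_def zero_word_def)
    have "h (c \<odot>\<^bsub>?A\<^esub> \<one>\<^bsub>?A\<^esub>) = c \<odot>\<^bsub>B\<^esub> \<one>\<^bsub>B\<^esub>"
      using hs[rule_format, OF 1(1)] ring_hom_one[OF hr] by simp
    then show "h (Poly_Mapping.single (Word []) c) = c \<odot>\<^bsub>B\<^esub> \<one>\<^bsub>B\<^esub>" by (simp add: 1(2))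
    assume "x \<in> G" "set xs \<subseteq> G"
    then have "Poly_Mapping.single (Word [x]) 1 \<in> carrier ?A" "Poly_Mapping.single (Word xs) c \<in> carrier ?A"
      by (auto simp: free_algebra_def)
    moreover have "Poly_Mapping.single (Word (x # xs)) c
        = Poly_Mapping.single (Word [x]) 1 \<otimes>\<^bsub>?A\<^esub> Poly_Mapping.single (Word xs) c"
      by (simp add: free_algebra_def mult_single plus_word_def)
    ultimately show "h (Poly_Mapping.single (Word (x # xs)) c)
      = h (Poly_Mapping.single (Word [x]) 1) \<otimes>\<^bsub>B\<^esub> h (Poly_Mapping.single (Word xs) c)"
      by (simp add: ring_hom_mult[OF hr])
  qed
  have "f (Poly_Mapping.single (Word xs) c) = g (Poly_Mapping.single (Word xs) c)"
    if "set xs \<subseteq> G" for xs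
    using that by (induction xs) (simp_all add: *[OF f] *[OF g] fg)
  then show ?case using single by (cases w) simp
next
  case (add x y)
  have *: "h (x + y) = h x \<oplus>\<^bsub>B\<^esub> h y" if "h \<in> algebra_hom (free_algebra G) B" for h
    using that add(1,2) ring_hom_add[of h "free_algebra G" B x y]
    by (simp add: algebra_hom_def) (simp add: free_algebra_def)
  show ?case using add by (simp add: *[OF f] *[OF g])
qed


section \<open>Doubling a point\<close>

text \<open>This is the surjection \<open>\<sigma>\<close>. For \<open>a = 0\<close> it identifies
  \<open>0\<close> and \<open>1\<close>; as indices start at \<open>1\<close>, taking preimages is
  then just the shift by one.\<close>

definition merge :: "nat \<Rightarrow> nat \<Rightarrow> nat" where
  "merge a i = (if i \<le> a then i else i - 1)"

definition double :: "nat \<Rightarrow> nat set \<Rightarrow> nat set" where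
  "double a I = merge a -` I"

lemma merge_mono: "i \<le> j \<Longrightarrow> merge a i \<le> merge a j"
  by (auto simp: merge_def)

lemma merge_less_imp: "merge a i < merge a j \<Longrightarrow> i < j"
  by (metis merge_mono not_le)

lemma merge_surj: "\<exists>i. merge a i = j"
proof (cases "j \<le> a")
  case True
  then show ?thesis by (intro exI[of _ j]) (simp add: merge_def)
next
  case False
  then show ?thesis by (intro exI[of _ "Suc j"]) (simp add: merge_def)
qed

text \<open>By surjectivity a set is recovered from its preimage, which is what allows properties of
  \<open>double a I\<close> to be carried back to \<open>I\<close>.\<close>

lemma merge_image_double: "merge a ` double a I = I"
  using merge_surj unfolding double_def by (metis image_vimage_eq inf_top_right surj_def)

lemma double_empty_iff: "double a I = {} \<longleftrightarrow> I = {}"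
  by (metis merge_image_double double_def image_empty vimage_empty)

lemma double_Un: "double a (I \<union> J) = double a I \<union> double a J"
  and double_Int: "double a (I \<inter> J) = double a I \<inter> double a J"
  by (auto simp: double_def)

lemma double_mono: "I \<subseteq> J \<Longrightarrow> double a I \<subseteq> double a J"
  by (auto simp: double_def)

text \<open>The two tests combine to the three cases in the definition of
  \<open>\<delta>\<^sub>a\<close>; \<open>j \<le> k\<close> excludes the fourth combination
  \<open>k < a < j\<close>.\<close>

lemma double_atLeastAtMost:
  assumes "j \<le> k"
  shows "double a {j..k} = {(if a < j then j + 1 else j)..(if k < a then k else k + 1)}"
  using assms by (auto simp: double_def merge_def split: if_splits)

text \<open>A discrete intermediate value property: a value strictly between the end values is
  attained somewhere by surjectivity, and by monotonicity this happens between \<open>x\<close> and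
  \<open>y\<close>.\<close>

lemma merge_image_atLeastAtMost: "x \<le> y \<Longrightarrow> merge a ` {x..y} = {merge a x..merge a y}"
proof (intro subset_antisym subsetI)
  fix z assume "x \<le> y" and z: "z \<in> {merge a x..merge a y}"
  obtain w where w: "merge a w = z" using merge_surj by blast
  consider "z = merge a x" | "z = merge a y" | "merge a x < merge a w" "merge a w < merge a y"
    using z w by fastforce
  then show "z \<in> merge a ` {x..y}"
  proof cases
    case 3
    then have "x < w" "w < y" by (auto dest: merge_less_imp)
    then show ?thesis using w by force
  qed (use \<open>x \<le> y\<close> in auto)
qed (auto intro: merge_mono)

text \<open>An equivalence is required: \<open>C2\<close> branches on adjacency, so non-adjacent
  sets must also stay non-adjacent.\<close>

lemma connected_set_double: "connected_set (double a I) \<longleftrightarrow> connected_set I"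
proof
  assume "connected_set (double a I)"
  then obtain x y where xy: "double a I = {x..y}" "x \<le> y" by (rule connected_setE)
  then have "I = {merge a x..merge a y}"
    using merge_image_double[of a I] merge_image_atLeastAtMost by simp
  then show "connected_set I" using xy merge_mono by (simp add: connected_atLeastAtMost)
next
  assume "connected_set I"
  then obtain j k where "I = {j..k}" "j \<le> k" by (rule connected_setE)
  then show "connected_set (double a I)"
    by (simp add: double_atLeastAtMost connected_atLeastAtMost)
qed

lemma set_less_double: "set_less I J \<Longrightarrow> set_less (double a I) (double a J)"
  by (auto simp: set_less_def double_def dest: merge_less_imp)

lemma adjacent_double: "adjacent (double a I) (double a J) \<longleftrightarrow> adjacent I J"
  by (simp add: adjacent_def connected_set_double double_empty_iff
      flip: double_Un double_Int)

text \<open>If \<open>h\<close> lies strictly beyond the preimage of \<open>I\<close>, monotonicity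
  gives the weak inequality between values. Equality is impossible, since \<open>h\<close> would
  then belong to that preimage itself.\<close>

lemma double_less_iff:
  "(\<forall>i\<in>double a I. i < h) \<longleftrightarrow> (\<forall>i\<in>I. i < merge a h)"
  "(\<forall>i\<in>double a I. h < i) \<longleftrightarrow> (\<forall>i\<in>I. merge a h < i)"
proof -
  have mem: "i \<in> double a I \<longleftrightarrow> merge a i \<in> I" for i by (simp add: double_def)
  have "merge a i < merge a h" if "\<forall>i\<in>double a I. i < h" "merge a i \<in> I" for i
    using that merge_mono[of i h a] mem by (metis le_neq_implies_less less_irrefl less_imp_le)
  moreover have "merge a h < merge a i" if "\<forall>i\<in>double a I. h < i" "merge a i \<in> I" for i
    using that merge_mono[of h i a] mem by (metis le_neq_implies_less less_irrefl less_imp_le)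
  ultimately show "(\<forall>i\<in>double a I. i < h) \<longleftrightarrow> (\<forall>i\<in>I. i < merge a h)"
    "(\<forall>i\<in>double a I. h < i) \<longleftrightarrow> (\<forall>i\<in>I. merge a h < i)"
    by (metis mem merge_less_imp merge_surj)+
qed

lemma hole_double: "hole (double a I) (double a J) = double a (hole I J)"
  by (simp add: hole_def set_less_def double_less_iff) (simp add: double_def)

lemma double_generators:
  assumes "I \<in> generators n" "a \<le> n"
  shows "double a I \<in> generators (n + 1)"
proof -
  have "i \<in> {1..n + 1}" if "merge a i \<in> {1..n}" for i
    using that by (auto simp: merge_def split: if_splits)
  then have "double a I \<subseteq> {1..n + 1}"
    using assms(1) by (auto simp: generators_def double_def)
  then show ?thesis using assms by (simp add: generators_def connected_set_double)
qed

lemma monotonic_adjacent_double: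
  "monotonic_adjacent Is \<Longrightarrow> monotonic_adjacent (map (double a) Is)"
  unfolding monotonic_adjacent_def successively_map
  using successively_mono[of set_less Is "\<lambda>I J. set_less (double a I) (double a J)"]
    successively_mono[of "\<lambda>I J. set_less J I" Is "\<lambda>I J. set_less (double a J) (double a I)"]
  by (auto simp: connected_set_double adjacent_double set_less_double)


section \<open>Preservation of the relations\<close>

text \<open>The convention \<open>C {} = 1\<close> is respected because only the empty set has an
  empty preimage.\<close>

lemma free_algebra_map_C: "free_algebra_map (double a) (C I) = C (double a I)"
  by (simp add: C_def double_empty_iff)

lemma free_algebra_map_q_commutator:
  "free_algebra_map f (q_commutator x y) = q_commutator (free_algebra_map f x) (free_algebra_map f y)"
  by (simp add: q_commutator_def free_algebra_map_mult free_algebra_map_diff map_word_zero)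

text \<open>Both sides take the same branch by \<open>adjacent_double\<close>; in the other branch
  the holes correspond by \<open>hole_double\<close>, and unions commute with preimages.\<close>

lemma free_algebra_map_C2:
  "free_algebra_map (double a) (C2 I J) = C2 (double a I) (double a J)"
  by (simp add: C2_def Let_def adjacent_double hole_double free_algebra_map_C free_algebra_map_add
      free_algebra_map_mult free_algebra_map_uminus free_algebra_map_q_commutator double_Un
      free_algebra_map_diff)

lemmas free_algebra_map_simps =
  free_algebra_map_add free_algebra_map_mult free_algebra_map_uminus free_algebra_map_diff
  free_algebra_map_q_commutator free_algebra_map_C free_algebra_map_C2 double_Un

lemma free_algebra_map_relations:
  assumes "x \<in> relations n" "a \<le> n"
  shows "free_algebra_map (double a) x \<in> relations (n + 1)"
  using assms(1)
proof cases
  case (commute I J)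
  have "double a I \<inter> double a J = {} \<or> double a I \<subseteq> double a J"
    using commute(4) double_mono by (auto simp: double_empty_iff simp flip: double_Int)
  then show ?thesis unfolding commute(1) free_algebra_map_simps
    using commute double_generators assms(2) by (intro relations.commute)
next
  case (three I1 I2 I3)
  show ?thesis unfolding three(1) free_algebra_map_simps
    using three double_generators assms(2) monotonic_adjacent_double[OF three(3), of a]
    by (intro relations.three) auto
next
  case (four I1 I2 I3 I4)
  \<comment> \<open>The set \<open>I2\<close> does not occur in the element of relation (iii), only
    in its side conditions, so its image has to be supplied by hand.\<close>
  show ?thesis unfolding four(1) free_algebra_map_simps
    using four double_generators assms(2) monotonic_adjacent_double[OF four(3), of a]
    by (intro relations.four[of _ "double a I2"]) auto
qed

section \<open>Descent from the free algebras to \<open>aw n\<close>\<close>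

lemma relation_ideal: "ideal (relation_ideal n) (free_aw_alg n)"
  unfolding relation_ideal_def
  by (rule ring.genideal_ideal[OF free_algebra_ring relations_carrier])

lemma double_hom:
  assumes "a \<le> n"
  shows "free_algebra_map (double a) \<in> algebra_hom (free_aw_alg n) (free_aw_alg (n + 1))"
  using assms by (intro free_algebra_map_hom) (auto dest: double_generators)

lemma free_algebra_map_relation_ideal:
  assumes a: "a \<le> n"
  shows "free_algebra_map (double a) ` relation_ideal n \<subseteq> relation_ideal (n + 1)"
proof -
  let ?F = "free_algebra_map (double a)" and ?A = "free_aw_alg n" and ?B = "free_aw_alg (n + 1)"
  interpret A: ring ?A by (rule free_algebra_ring)
  interpret F: ring_hom_ring ?A ?B ?F
    using double_hom[OF a] by (intro ring_hom_ringI2 free_algebra_ring) (simp add: algebra_hom_def)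
  \<comment> \<open>The preimage of the target ideal is an ideal containing all relations, hence it
    contains the ideal they generate.\<close>
  let ?K = "{x \<in> carrier ?A. ?F x \<in> relation_ideal (n + 1)}"
  have "ideal ?K ?A" using F.ideal_vimage[OF relation_ideal] .
  moreover have "?F x \<in> relation_ideal (n + 1)" if "x \<in> relations n" for x
    using free_algebra_map_relations[OF that a] ring.genideal_self[OF free_algebra_ring relations_carrier]
    unfolding relation_ideal_def by blast
  ultimately have "relation_ideal n \<subseteq> ?K"
    unfolding relation_ideal_def[of n] using relations_carrier
    by (intro A.genideal_minimal) auto
  then show ?thesis by blast
qed

text \<open>Composing with the projection from the free algebra reduces the claim to
  \<open>free_algebra_hom_eqI\<close>.\<close>

lemma aw_hom_eqI:
  assumes f: "f \<in> algebra_hom (aw n) B" and g: "g \<in> algebra_hom (aw n) B"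
    and fg: "\<And>I. I \<in> generators n \<Longrightarrow> f (aw_C n I) = g (aw_C n I)"
    and X: "X \<in> carrier (aw n)"
  shows "f X = g X"
proof -
  let ?p = "\<lambda>x. relation_ideal n +>\<^bsub>free_aw_alg n\<^esub> x"
  have p: "?p \<in> algebra_hom (free_aw_alg n) (aw n)"
    unfolding aw_def by (rule quotient_algebra_projection[OF relation_ideal])
  obtain x where x: "x \<in> carrier (free_aw_alg n)" "X = ?p x"
    using X by (auto simp: aw_def carrier_quotient_algebra)
  \<comment> \<open>Generators are non-empty sets, so \<open>C I\<close> is the one-letter word and
    not the unit.\<close>
  have "(f \<circ> ?p) (Poly_Mapping.single (Word [I]) 1) = (g \<circ> ?p) (Poly_Mapping.single (Word [I]) 1)"
    if "I \<in> generators n" for I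
    using fg[OF that] that by (auto simp: aw_C_def C_def generators_def connected_set_def)
  then have "(f \<circ> ?p) x = (g \<circ> ?p) x"
    by (rule free_algebra_hom_eqI[OF algebra_hom_comp[OF p f] algebra_hom_comp[OF p g] _ x(1)])
  then show ?thesis by (simp add: x)
qed

theorem proposition4p1:
  fixes n a :: nat
  assumes "n \<ge> 1" and "a \<le> n"
  shows "\<exists>!\<delta>. \<delta> \<in> algebra_hom (aw n) (aw (n + 1)) \<inter> extensional (carrier (aw n)) \<and>
    (\<forall>j k. 1 \<le> j \<and> j \<le> k \<and> k \<le> n \<longrightarrow>
      (k < a \<longrightarrow> \<delta> (aw_C n {j..k}) = aw_C (n + 1) {j..k}) \<and>
      (j \<le> a \<and> a \<le> k \<longrightarrow> \<delta> (aw_C n {j..k}) = aw_C (n + 1) {j..k + 1}) \<and>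
      (a < j \<longrightarrow> \<delta> (aw_C n {j..k}) = aw_C (n + 1) {j + 1..k + 1}))"
    (is "\<exists>!\<delta>. \<delta> \<in> _ \<inter> _ \<and> ?values \<delta>")
proof -
  \<comment> \<open>The three cases are replaced by one uniform formula, used for both existence and
    uniqueness.\<close>
  have values_iff: "?values \<delta> \<longleftrightarrow> (\<forall>I\<in>generators n. \<delta> (aw_C n I) = aw_C (n + 1) (double a I))"
    (is "_ \<longleftrightarrow> ?rhs") for \<delta>
  proof
    assume v: "?values \<delta>"
    show ?rhs
    proof
      fix I assume "I \<in> generators n"
      then obtain j k where "I = {j..k}" "1 \<le> j" "j \<le> k" "k \<le> n" by (rule generatorsE)
      then show "\<delta> (aw_C n I) = aw_C (n + 1) (double a I)"
        using v[rule_format, of j k] by (auto simp: double_atLeastAtMost not_less)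
    qed
  next
    assume r: ?rhs
    have "\<delta> (aw_C n {j..k}) = aw_C (n + 1) (double a {j..k})" if "1 \<le> j" "j \<le> k" "k \<le> n" for j k
      using r generators_atLeastAtMost that by blast
    then show "?values \<delta>" by (auto simp: double_atLeastAtMost)
  qed
  have "\<exists>h \<in> algebra_hom (aw n) (aw (n + 1)). \<forall>x \<in> carrier (free_aw_alg n).
      h (relation_ideal n +>\<^bsub>free_aw_alg n\<^esub> x)
        = relation_ideal (n + 1) +>\<^bsub>free_aw_alg (n + 1)\<^esub> free_algebra_map (double a) x"
    unfolding aw_def
    by (rule quotient_algebra_map[OF relation_ideal relation_ideal double_hom[OF assms(2)]
          free_algebra_map_relation_ideal[OF assms(2)]]) blast
  then obtain h where h: "h \<in> algebra_hom (aw n) (aw (n + 1))"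
    and hp: "\<And>x. x \<in> carrier (free_aw_alg n) \<Longrightarrow> h (relation_ideal n +>\<^bsub>free_aw_alg n\<^esub> x)
      = relation_ideal (n + 1) +>\<^bsub>free_aw_alg (n + 1)\<^esub> free_algebra_map (double a) x"
    by blast
  have aw_C_carrier: "aw_C n I \<in> carrier (aw n)" if "I \<in> generators n" for I
    using C_carrier[OF that] by (simp add: aw_def aw_C_def carrier_quotient_algebra)
  show ?thesis
  \<comment> \<open>The homomorphism laws say nothing about values off the carrier; restricting
    makes them \<open>undefined\<close>, as extensionality demands.\<close>
  proof (rule ex1I[of _ "restrict h (carrier (aw n))"])
    have "restrict h (carrier (aw n)) \<in> algebra_hom (aw n) (aw (n + 1))"
      using h unfolding aw_def by (intro algebra_hom_restrict relation_ideal)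
    moreover have "?values (restrict h (carrier (aw n)))"
      unfolding values_iff
      using aw_C_carrier C_carrier by (auto simp: aw_C_def hp free_algebra_map_C)
    ultimately show "restrict h (carrier (aw n)) \<in>
        algebra_hom (aw n) (aw (n + 1)) \<inter> extensional (carrier (aw n)) \<and>
        ?values (restrict h (carrier (aw n)))"
      by blast
    fix \<delta>
    assume "\<delta> \<in> algebra_hom (aw n) (aw (n + 1)) \<inter> extensional (carrier (aw n)) \<and> ?values \<delta>"
    then have dh: "\<delta> \<in> algebra_hom (aw n) (aw (n + 1))" and de: "\<delta> \<in> extensional (carrier (aw n))"
      and dv: "\<forall>I\<in>generators n. \<delta> (aw_C n I) = aw_C (n + 1) (double a I)"
      unfolding values_iff by blast+
    \<comment> \<open>Agreement on the classes of the generators suffices, as these determine a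
      homomorphism on \<open>aw n\<close>.\<close>
    have "\<delta> (aw_C n I) = h (aw_C n I)" if "I \<in> generators n" for I
      using dv that C_carrier[OF that] hp[of "C I"] by (simp add: aw_C_def free_algebra_map_C)
    then have "\<delta> X = h X" if "X \<in> carrier (aw n)" for X
      using aw_hom_eqI[OF dh h _ that] by blast
    then show "\<delta> = restrict h (carrier (aw n))"
      by (intro extensionalityI[OF de restrict_extensional]) simp
  qed
qed

end
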